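(* Let $\mathrm{G}$ be a finite metric space on the node set $V$ and let $v_0 \in V$. Then there exists a star metric $\mathrm{S}$ whose leaves are exactly the nodes of $V$, with edge weights $w_v \ge 0$ for the edge from the center to leaf $v$, such that: (1) $w(\mathrm{S}) = \sum_{v \in V} w_v$ equals $w(\mathrm{T}_{\mathrm{G}}(V))$, the weight of a minimum spanning tree of $\mathrm{G}$; (2) for every $V' \subseteq V$ with $v_0 \in V'$, we have $w(\mathrm{T}_{\mathrm{G}}(V')) \ge w_{\mathrm{S}}(V')$, where $w_{\mathrm{S}}(V') = \sum_{v \in V'} w_v$.
   Context: For a finite metric space $\mathrm{G}$ on node set $V$ with distance $w$ and a subset $V' \subseteq V$, $\mathrm{T}_{\mathrm{G}}(V')$ denotes a minimum-weight Steiner tree in $\mathrm{G}$ (viewed as the complete graph on $V$ with edge weights $w$) connecting all nodes of $V'$, and $w(\mathrm{T}_{\mathrm{G}}(V'))$ is its total edge weight; in particular $w(\mathrm{T}_{\mathrm{G}}(V))$ is the weight $\mathrm{MST}(\mathrm{G})$ of a minimum spanning tree. A star metric with leaves $V$ consists of a center $c$ and an edge of weight $w_v \ge 0$ from $c$ to each $v \in V$, the distance between leaves $u \ne v$ being $w_u + w_v$. *)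

theory Defs
  imports "HOL-Analysis.Analysis"
begin

text \<open>
  Graphs are finite, simple and undirected: a set \<open>U\<close> of nodes together with a set \<open>E\<close> of
  two-element subsets of \<open>U\<close>.  (The \<open>tree\<close> predicate of the AFP entry \<open>Graph_Theory\<close> is not used:
  it only forbids \<^emph>\<open>directed\<close> cycles, so it is not the notion of an undirected tree.)
\<close>

definition simple_graph :: "'a set \<Rightarrow> 'a set set \<Rightarrow> bool" where
  "simple_graph U E \<longleftrightarrow> finite U \<and> E \<subseteq> {{u, v} | u v. u \<in> U \<and> v \<in> U \<and> u \<noteq> v}"

definition adjacency :: "'a set set \<Rightarrow> ('a \<times> 'a) set" where
  "adjacency E = {(u, v). {u, v} \<in> E}"

definition graph_connected :: "'a set \<Rightarrow> 'a set set \<Rightarrow> bool" where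
  "graph_connected U E \<longleftrightarrow> U \<noteq> {} \<and> (\<forall>u\<in>U. \<forall>v\<in>U. (u, v) \<in> (adjacency E)\<^sup>*)"

text \<open>A cycle is listed by its pairwise distinct nodes; the last node is adjacent to the first.\<close>

definition graph_cycle :: "'a set set \<Rightarrow> 'a list \<Rightarrow> bool" where
  "graph_cycle E xs \<longleftrightarrow> 3 \<le> length xs \<and> distinct xs \<and>
     (\<forall>i<length xs. {xs ! i, xs ! (Suc i mod length xs)} \<in> E)"

definition graph_tree :: "'a set \<Rightarrow> 'a set set \<Rightarrow> bool" where
  "graph_tree U E \<longleftrightarrow> simple_graph U E \<and> graph_connected U E \<and> (\<nexists>xs. graph_cycle E xs)"

text \<open>For symmetric \<open>d\<close> the value below is well defined; see \<open>edge_weight_doubleton\<close>.\<close>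

definition edge_weight :: "('a \<Rightarrow> 'a \<Rightarrow> real) \<Rightarrow> 'a set \<Rightarrow> real" where
  "edge_weight d e = (THE x. \<exists>u v. e = {u, v} \<and> x = d u v)"

definition total_weight :: "('a \<Rightarrow> 'a \<Rightarrow> real) \<Rightarrow> 'a set set \<Rightarrow> real" where
  "total_weight d E = (\<Sum>e\<in>E. edge_weight d e)"

text \<open>
  Steiner trees for the terminals \<open>T\<close> in the complete graph on \<open>V\<close>; nodes of \<open>V - T\<close> may be used
  as Steiner nodes.
\<close>

definition steiner_tree :: "'a set \<Rightarrow> 'a set \<Rightarrow> 'a set \<Rightarrow> 'a set set \<Rightarrow> bool" where
  "steiner_tree V T U E \<longleftrightarrow> T \<subseteq> U \<and> U \<subseteq> V \<and> graph_tree U E"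

text \<open>
  The minimum is taken over a finite set, which is nonempty whenever \<open>T\<close> is a nonempty subset of
  the finite set \<open>V\<close>; see \<open>steiner_weight_attained\<close>.
\<close>

definition steiner_weight :: "'a set \<Rightarrow> ('a \<Rightarrow> 'a \<Rightarrow> real) \<Rightarrow> 'a set \<Rightarrow> real" where
  "steiner_weight V d T = Min {total_weight d E | U E. steiner_tree V T U E}"

definition mst_weight :: "'a set \<Rightarrow> ('a \<Rightarrow> 'a \<Rightarrow> real) \<Rightarrow> real" where
  "mst_weight V d = Min {total_weight d E | E. graph_tree V E}"

text \<open>
  A star metric \<open>D\<close> with leaf set \<open>V\<close> and edge weights \<open>w\<close>.  Its points are \<open>None\<close> (the center)
  and \<open>Some v\<close> for \<open>v \<in> V\<close>, so that the center is never itself a leaf.  Zero edge weights are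
  allowed, hence distinct points may have distance \<open>0\<close>.
\<close>

definition star_metric ::
    "'a set \<Rightarrow> ('a \<Rightarrow> real) \<Rightarrow> ('a option \<Rightarrow> 'a option \<Rightarrow> real) \<Rightarrow> bool" where
  "star_metric V w D \<longleftrightarrow>
     (\<forall>v\<in>V. 0 \<le> w v) \<and>
     D None None = 0 \<and>
     (\<forall>v\<in>V. D None (Some v) = w v \<and> D (Some v) None = w v) \<and>
     (\<forall>u\<in>V. \<forall>v\<in>V. D (Some u) (Some v) = (if u = v then 0 else w u + w v))"

lemma edge_weight_doubleton:
  assumes "\<And>x y. d x y = d y x"
  shows "edge_weight d {u, v} = d u v"
  unfolding edge_weight_def
  by (rule the_equality) (auto simp: doubleton_eq_iff assms)

lemma steiner_tree_all_iff: "steiner_tree V V U E \<longleftrightarrow> U = V \<and> graph_tree V E"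
  by (auto simp: steiner_tree_def)

lemma steiner_weight_eq_mst_weight: "steiner_weight V d V = mst_weight V d"
  by (simp add: steiner_weight_def mst_weight_def steiner_tree_all_iff)

lemma finite_steiner_weights:
  assumes "finite V"
  shows "finite {total_weight d E | U E. steiner_tree V T U E}"
proof (rule finite_subset)
  have "E \<subseteq> Pow V" if "steiner_tree V T U E" for U E
  proof
    fix e assume "e \<in> E"
    with that obtain u v where "e = {u, v}" "u \<in> U" "v \<in> U" "U \<subseteq> V"
      by (auto simp: steiner_tree_def graph_tree_def simple_graph_def)
    then show "e \<in> Pow V" by auto
  qed
  then show "{total_weight d E | U E. steiner_tree V T U E} \<subseteq> total_weight d ` Pow (Pow V)"
    by fast
qed (use assms in simp)

lemma graph_tree_star:
  assumes "finite V" and r: "r \<in> V"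
  shows "graph_tree V {{r, v} | v. v \<in> V - {r}}" (is "graph_tree V ?E")
proof -
  have "simple_graph V ?E"
    using assms unfolding simple_graph_def by blast
  moreover have "graph_connected V ?E"
  proof -
    have "(r, v) \<in> (adjacency ?E)\<^sup>*" "(v, r) \<in> (adjacency ?E)\<^sup>*" if "v \<in> V" for v
    proof -
      have "(r, v) \<in> adjacency ?E \<and> (v, r) \<in> adjacency ?E" if "v \<noteq> r"
        using that \<open>v \<in> V\<close> unfolding adjacency_def by (auto simp: insert_commute)
      then show "(r, v) \<in> (adjacency ?E)\<^sup>*" "(v, r) \<in> (adjacency ?E)\<^sup>*"
        by (cases "v = r"; auto)+
    qed
    then show ?thesis
      using r unfolding graph_connected_def by (blast intro: rtrancl_trans)
  qed
  moreover have False if "graph_cycle ?E xs" for xs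
  proof -
    let ?n = "length xs"
    have n: "3 \<le> ?n" and dist: "distinct xs"
      and edge: "\<And>i. i < ?n \<Longrightarrow> r \<in> {xs ! i, xs ! (Suc i mod ?n)}"
      using that unfolding graph_cycle_def by blast+
    have inj: "i = j" if "xs ! i = xs ! j" "i < ?n" "j < ?n" for i j
      using that dist nth_eq_iff_index_eq by blast
    obtain k where k: "k < ?n" "r = xs ! k"
      using edge[of 0] n mod_less_divisor[of ?n "Suc 0"] by fastforce
    have "k = i \<or> k = Suc i mod ?n" if "i < ?n" for i
      using edge[OF that] k inj[of k i] inj[of k "Suc i mod ?n"] that n
        mod_less_divisor[of ?n "Suc i"] by fastforce
    from this[of 0] this[of 1] this[of 2]
    have "k = 0 \<or> k = 1" "k = 1 \<or> k = 2" "k = 2 \<or> k = 3 mod ?n"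
      using n by (auto simp: numeral_3_eq_3 numeral_2_eq_2 simp flip: length_greater_0_conv)
    moreover have "3 mod ?n \<noteq> 1"
      using n by (cases "?n = 3") simp_all
    ultimately show False by linarith
  qed
  ultimately show ?thesis unfolding graph_tree_def by blast
qed

lemma steiner_weight_attained:
  assumes "finite V" and "T \<subseteq> V" and "T \<noteq> {}"
  obtains U E where "steiner_tree V T U E" and "total_weight d E = steiner_weight V d T"
    and "\<And>U' E'. steiner_tree V T U' E' \<Longrightarrow> total_weight d E \<le> total_weight d E'"
proof -
  let ?W = "{total_weight d E | U E. steiner_tree V T U E}"
  from assms obtain r where "r \<in> V" by blast
  with assms have "steiner_tree V T V {{r, v} | v. v \<in> V - {r}}"
    unfolding steiner_tree_def by (intro conjI graph_tree_star) auto
  then have ne: "?W \<noteq> {}" by blast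
  have fin: "finite ?W" using assms(1) by (rule finite_steiner_weights)
  have "steiner_weight V d T \<in> ?W"
    unfolding steiner_weight_def by (rule Min_in[OF fin ne])
  then obtain U E where *: "steiner_tree V T U E" "total_weight d E = steiner_weight V d T"
    by (smt (verit) mem_Collect_eq)
  show thesis
  proof (rule that[OF *])
    fix U' E' assume "steiner_tree V T U' E'"
    then have "total_weight d E' \<in> ?W" by blast
    then show "total_weight d E \<le> total_weight d E'"
      unfolding *(2) steiner_weight_def by (rule Min_le[OF fin])
  qed
qed

end

theory Submission
  imports Defs
begin

text \<open>
  Root a minimum spanning tree at \<open>v0\<close> and let \<open>w v\<close> be the weight of the edge from \<open>v\<close> to its
  parent, with \<open>w v0 = 0\<close>.  Given a Steiner tree with edges \<open>E\<close> and nodes \<open>U\<close>, where \<open>v0 \<in> U\<close>,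
  add to it the parent edges of the nodes outside \<open>U\<close>: following parents from such a node eventually
  leads into \<open>U\<close>, so the result connects all of \<open>V\<close> and weighs at least as much as the minimum
  spanning tree.  Cancelling the common parent edges leaves \<open>(\<Sum>v\<in>U. w v) \<le> total_weight d E\<close>.
\<close>

section \<open>Parent functions and the forests they describe\<close>

text \<open>The height \<open>h\<close> certifies that iterating \<open>p\<close> from a node of
  \<open>V\<close> ends in \<open>R\<close>. A root set \<open>R\<close> instead of a single root
  lets the same \<open>p\<close> describe both a tree rooted at one node and a forest hanging from a
  Steiner tree.\<close>

definition parent_function :: "'a set \<Rightarrow> 'a set \<Rightarrow> ('a \<Rightarrow> 'a) \<Rightarrow> ('a \<Rightarrow> nat) \<Rightarrow> bool" where
  "parent_function V R p h \<longleftrightarrow> (\<forall>v\<in>V - R. p v \<in> V \<and> h (p v) < h v)"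

definition parent_edges :: "('a \<Rightarrow> 'a) \<Rightarrow> 'a set \<Rightarrow> 'a set set" where
  "parent_edges p A = (\<lambda>v. {v, p v}) ` A"

lemma parent_functionD:
  assumes "parent_function V R p h" "v \<in> V" "v \<notin> R"
  shows "p v \<in> V" "h (p v) < h v" "p v \<noteq> v"
proof -
  show "p v \<in> V" and less: "h (p v) < h v" using assms by (auto simp: parent_function_def)
  from less show "p v \<noteq> v" by auto
qed

lemma parent_function_mono:
  "parent_function V R p h \<Longrightarrow> R \<subseteq> U \<Longrightarrow> parent_function V U p h"
  by (auto simp: parent_function_def)

lemma sym_adjacency: "sym (adjacency E)"
  by (auto simp: adjacency_def sym_def insert_commute)

lemma adjacency_mono: "E \<subseteq> F \<Longrightarrow> adjacency E \<subseteq> adjacency F"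
  by (auto simp: adjacency_def)

lemma graph_connectedI:
  assumes "r \<in> V" and reach: "\<And>v. v \<in> V \<Longrightarrow> (r, v) \<in> (adjacency E)\<^sup>*"
  shows "graph_connected V E"
proof -
  have "(u, r) \<in> (adjacency E)\<^sup>*" if "u \<in> V" for u
    using reach[OF that] by (rule symD[OF sym_rtrancl[OF sym_adjacency]])
  then show ?thesis
    using assms unfolding graph_connected_def by (blast intro: rtrancl_trans)
qed

text \<open>Induction on \<open>h v\<close>: the parent of a node outside \<open>U\<close> is lower,
  hence already reachable from a fixed node \<open>r\<close> of \<open>U\<close>, and one parent
  edge remains to be added.\<close>

lemma graph_connected_parent_edges:
  assumes U: "graph_connected U E" and "U \<subseteq> V" and p: "parent_function V U p h"
  shows "graph_connected V (E \<union> parent_edges p (V - U))"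
proof -
  let ?F = "E \<union> parent_edges p (V - U)"
  from U obtain r where r: "r \<in> U" by (auto simp: graph_connected_def)
  have "(r, v) \<in> (adjacency ?F)\<^sup>*" if "v \<in> V" for v
    using that
  proof (induction "h v" arbitrary: v rule: less_induct)
    case less
    show ?case
    proof (cases "v \<in> U")
      case True
      then have "(r, v) \<in> (adjacency E)\<^sup>*" using U r by (auto simp: graph_connected_def)
      then show ?thesis using rtrancl_mono[OF adjacency_mono[of E ?F]] by auto
    next
      case False
      have "(r, p v) \<in> (adjacency ?F)\<^sup>*"
        using less parent_functionD[OF p less.prems False] by blast
      moreover have "(p v, v) \<in> adjacency ?F"
        using less.prems False by (auto simp: adjacency_def parent_edges_def insert_commute)
      ultimately show ?thesis by (rule rtrancl_into_rtrancl)
    qed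
  qed
  then show ?thesis using r \<open>U \<subseteq> V\<close> by (intro graph_connectedI[of r]) auto
qed

lemma simple_graph_parent_edges:
  assumes "finite V" and "parent_function V R p h"
  shows "simple_graph V (parent_edges p (V - R))"
  using assms(1) parent_functionD[OF assms(2)]
  unfolding simple_graph_def parent_edges_def by fast

lemma no_cycle_parent_edges:
  assumes p: "parent_function V R p h"
  shows "\<not> graph_cycle (parent_edges p (V - R)) xs"
proof
  assume "graph_cycle (parent_edges p (V - R)) xs"
  then have n: "3 \<le> length xs" and dist: "distinct xs"
    and edge: "\<And>i. i < length xs \<Longrightarrow>
      {xs ! i, xs ! (Suc i mod length xs)} \<in> parent_edges p (V - R)"
    by (auto simp: graph_cycle_def)
  let ?n = "length xs"
  have "Max (h ` set xs) \<in> h ` set xs" using n by (intro Max_in) auto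
  then obtain k where k: "k < ?n" and "h (xs ! k) = Max (h ` set xs)"
    by (auto simp: in_set_conv_nth)
  then have top: "h (xs ! i) \<le> h (xs ! k)" if "i < ?n" for i using that by auto
  \<comment> \<open>Both neighbours on the cycle of a node of maximal height would be its parent.\<close>
  have par: "xs ! i = p (xs ! k)"
    if "i < ?n" and "{xs ! k, xs ! i} \<in> parent_edges p (V - R)" for i
    using that top[OF that(1)] parent_functionD[OF p]
    by (fastforce simp: parent_edges_def doubleton_eq_iff)
  \<comment> \<open>Positions of the two neighbours of \<open>xs ! k\<close> on the cycle, wrapping
    around at either end of the list. The edge listed at index \<open>pred\<close> joins
    \<open>xs ! pred\<close> to \<open>xs ! k\<close>.\<close>
  define succ where "succ = Suc k mod ?n"
  define pred where "pred = (if k = 0 then ?n - 1 else k - 1)"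
  have "0 < ?n" using k by linarith
  then have lt: "succ < ?n" unfolding succ_def by (rule mod_less_divisor)
  have lt': "pred < ?n" using k by (auto simp: pred_def)
  have "Suc pred mod ?n = k" using k by (auto simp: pred_def)
  with edge[OF k] edge[OF lt'] have "xs ! succ = xs ! pred"
    using par lt lt' by (metis succ_def insert_commute)
  then have "succ = pred" using dist lt lt' nth_eq_iff_index_eq by blast
  \<comment> \<open>The two positions could coincide only in a list of fewer than three
    nodes.\<close>
  moreover have "succ \<noteq> pred"
  proof (cases "Suc k = ?n")
    case True
    then show ?thesis using n by (auto simp: succ_def pred_def)
  next
    case False
    then show ?thesis using n k by (auto simp: succ_def pred_def)
  qed
  ultimately show False by blast
qed

lemma graph_tree_parent_edges:
  assumes "finite V" and "r \<in> V" and p: "parent_function V {r} p h"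
  shows "graph_tree V (parent_edges p (V - {r}))"
proof -
  \<comment> \<open>The one-node graph without edges is the base to which all parent edges are
    attached.\<close>
  have "graph_connected {r} {}" by (auto simp: graph_connected_def)
  from graph_connected_parent_edges[OF this _ p] \<open>r \<in> V\<close>
  have "graph_connected V (parent_edges p (V - {r}))" by simp
  then show ?thesis
    using simple_graph_parent_edges[OF assms(1) p] no_cycle_parent_edges[OF p]
    by (auto simp: graph_tree_def)
qed

text \<open>Two distinct nodes with the same parent edge would be parents of each other, so each
  would be lower than the other.\<close>

lemma inj_on_parent_edges:
  assumes p: "parent_function V R p h"
  shows "inj_on (\<lambda>v. {v, p v}) (V - R)"
proof (rule inj_onI)
  fix u v assume uv: "u \<in> V - R" "v \<in> V - R" "{u, p u} = {v, p v}"
  then have "h (p u) < h u" "h (p v) < h v" using parent_functionD[OF p] by auto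
  then show "u = v" using uv(3) by (auto simp: doubleton_eq_iff)
qed

lemma total_weight_parent_edges:
  assumes p: "parent_function V R p h" and sym: "\<And>x y. d x y = d y x"
  shows "total_weight d (parent_edges p (V - R)) = (\<Sum>v\<in>V - R. d v (p v))"
  unfolding total_weight_def parent_edges_def
  by (simp add: sum.reindex[OF inj_on_parent_edges[OF p]] edge_weight_doubleton[OF sym])

text \<open>The height is the number of edges on a shortest path from the root.\<close>

lemma parent_function_exists:
  assumes "simple_graph V E" and "graph_connected V E" and "r \<in> V"
  obtains p h where "parent_function V {r} p h" and "parent_edges p (V - {r}) \<subseteq> E"
proof -
  define h where "h v = (LEAST n. (r, v) \<in> adjacency E ^^ n)" for v
  have "\<exists>u. u \<in> V \<and> {v, u} \<in> E \<and> h u < h v" if v: "v \<in> V - {r}" for v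
  proof -
    have "(r, v) \<in> (adjacency E)\<^sup>*" using assms v by (auto simp: graph_connected_def)
    then have path: "(r, v) \<in> adjacency E ^^ h v"
      unfolding h_def by (metis LeastI rtrancl_imp_relpow)
    \<comment> \<open>A path of length zero from \<open>r\<close> ends in \<open>r\<close>, so
      \<open>v \<noteq> r\<close> has positive height. The parent is the last node before
      \<open>v\<close> on a shortest path.\<close>
    with v obtain m where m: "h v = Suc m" by (cases "h v") auto
    with path obtain u where u: "(r, u) \<in> adjacency E ^^ m" and e: "{u, v} \<in> E"
      by (auto simp: adjacency_def)
    have "h u \<le> m" unfolding h_def using u by (rule Least_le)
    moreover have "u \<in> V" using e assms(1) by (auto simp: simple_graph_def doubleton_eq_iff)
    ultimately show ?thesis using e m by (auto simp: insert_commute)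
  qed
  then obtain p where "\<And>v. v \<in> V - {r} \<Longrightarrow> p v \<in> V \<and> {v, p v} \<in> E \<and> h (p v) < h v"
    by metis
  then show thesis
    by (intro that[of p h]) (auto simp: parent_function_def parent_edges_def)
qed

section \<open>Weights of spanning subgraphs and minimum spanning trees\<close>

lemma finite_simple_graph: "simple_graph V E \<Longrightarrow> finite E"
  by (rule finite_subset[of _ "Pow V"]) (auto simp: simple_graph_def)

lemma edge_weight_nonneg:
  assumes "simple_graph V E" "e \<in> E" "\<And>x y. d x y = d y x" "\<And>x y. 0 \<le> d x y"
  shows "0 \<le> edge_weight d e"
  using assms(1,2) edge_weight_doubleton[of d, OF assms(3)] assms(4)
  by (fastforce simp: simple_graph_def)

lemma mst_weight_le_tree:
  assumes "finite V" and "graph_tree V E"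
  shows "mst_weight V d \<le> total_weight d E"
proof -
  have "finite {total_weight d E | E. graph_tree V E}"
    using finite_steiner_weights[OF assms(1), of d V] by (simp add: steiner_tree_all_iff)
  then show ?thesis
    unfolding mst_weight_def by (rule Min_le) (use assms(2) in blast)
qed

text \<open>The parent edges for any root form a spanning tree inside \<open>E\<close>; discarding
  the other edges cannot raise the total, as weights are nonnegative.\<close>

lemma mst_weight_le_connected:
  assumes E: "simple_graph V E" "graph_connected V E"
    and sym: "\<And>x y. d x y = d y x" and nonneg: "\<And>x y. 0 \<le> d x y"
  shows "mst_weight V d \<le> total_weight d E"
proof -
  obtain r where r: "r \<in> V" using E(2) by (auto simp: graph_connected_def)
  obtain p h where p: "parent_function V {r} p h" and sub: "parent_edges p (V - {r}) \<subseteq> E"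
    using parent_function_exists[OF E r] .
  have "finite V" using E(1) by (simp add: simple_graph_def)
  then have "mst_weight V d \<le> total_weight d (parent_edges p (V - {r}))"
    by (intro mst_weight_le_tree graph_tree_parent_edges[OF _ r p])
  also have "\<dots> \<le> total_weight d E"
    unfolding total_weight_def
    using edge_weight_nonneg[OF E(1) _ sym nonneg]
    by (intro sum_mono2[OF finite_simple_graph[OF E(1)] sub]) auto
  finally show ?thesis .
qed

text \<open>Edges common to \<open>E\<close> and \<open>F\<close> are counted twice on the
  right.\<close>

lemma total_weight_Un_le:
  assumes "simple_graph V E" "simple_graph V F"
    and "\<And>x y. d x y = d y x" and "\<And>x y. 0 \<le> d x y"
  shows "total_weight d (E \<union> F) \<le> total_weight d E + total_weight d F"
proof -
  have "0 \<le> sum (edge_weight d) (E \<inter> F)"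
    using edge_weight_nonneg[OF assms(1) _ assms(3,4)] by (intro sum_nonneg) auto
  then show ?thesis
    using sum.union_inter[of E F "edge_weight d"] assms(1,2)[THEN finite_simple_graph]
    by (simp add: total_weight_def)
qed

text \<open>The parent edges taken from a minimum spanning tree \<open>E\<close> again form a
  spanning tree, so their weight lies between the minimum and the weight of \<open>E\<close>. This
  gives equality without proving that they exhaust \<open>E\<close>.\<close>

lemma mst_rooted_exists:
  assumes "finite V" and "r \<in> V"
    and sym: "\<And>x y. d x y = d y x" and nonneg: "\<And>x y. 0 \<le> d x y"
  obtains p h where "parent_function V {r} p h" and "(\<Sum>v\<in>V - {r}. d v (p v)) = mst_weight V d"
proof -
  obtain U E where "steiner_tree V V U E" and weight: "total_weight d E = steiner_weight V d V"
    using steiner_weight_attained[OF assms(1), of V] assms(2) by blast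
  then have E: "simple_graph V E" "graph_connected V E"
    by (auto simp: steiner_tree_all_iff graph_tree_def)
  obtain p h where p: "parent_function V {r} p h" and sub: "parent_edges p (V - {r}) \<subseteq> E"
    using parent_function_exists[OF E assms(2)] .
  have "mst_weight V d \<le> total_weight d (parent_edges p (V - {r}))"
    by (intro mst_weight_le_tree graph_tree_parent_edges[OF _ assms(2) p] assms(1))
  moreover have "total_weight d (parent_edges p (V - {r})) \<le> total_weight d E"
    unfolding total_weight_def
    using edge_weight_nonneg[OF E(1) _ sym nonneg]
    by (intro sum_mono2[OF finite_simple_graph[OF E(1)] sub]) auto
  ultimately show thesis
    using weight total_weight_parent_edges[of V "{r}" p h d, OF p sym]
    by (intro that[OF p]) (simp add: steiner_weight_eq_mst_weight)
qed

theorem theorem2: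
  fixes V :: "'a set" and d :: "'a \<Rightarrow> 'a \<Rightarrow> real" and v0 :: 'a
  assumes "finite V" and "Metric_space V d" and "v0 \<in> V"
  shows "\<exists>w D. star_metric V w D \<and>
           (\<Sum>v\<in>V. w v) = steiner_weight V d V \<and>
           steiner_weight V d V = mst_weight V d \<and>
           (\<forall>V'. V' \<subseteq> V \<and> v0 \<in> V' \<longrightarrow> steiner_weight V d V' \<ge> (\<Sum>v\<in>V'. w v))"
proof -
  have sym: "d x y = d y x" and nonneg: "0 \<le> d x y" for x y
    using Metric_space.commute[OF assms(2)] Metric_space.nonneg[OF assms(2)] by auto
  obtain p h where p: "parent_function V {v0} p h"
    and mst: "(\<Sum>v\<in>V - {v0}. d v (p v)) = mst_weight V d"
    using mst_rooted_exists[of V v0 d, OF assms(1,3) sym nonneg] .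
  define w where "w v = (if v = v0 then 0 else d v (p v))" for v
  \<comment> \<open>Distances run through the center, which is treated as a point at distance 0 from
    itself; the diagonal is set to 0 separately.\<close>
  define D where "D x y = (if x = y then 0 else
    (case x of None \<Rightarrow> 0 | Some u \<Rightarrow> w u) + (case y of None \<Rightarrow> 0 | Some v \<Rightarrow> w v))" for x y
  have w_nonneg: "0 \<le> w v" for v by (simp add: w_def nonneg)
  have star: "star_metric V w D"
    by (auto simp: star_metric_def D_def w_nonneg)
  have "(\<Sum>v\<in>V. w v) = (\<Sum>v\<in>V - {v0}. w v)"
    by (subst sum.remove[OF assms(1,3)]) (simp add: w_def)
  also have "\<dots> = mst_weight V d"
    unfolding mst[symmetric] by (rule sum.cong) (auto simp: w_def)
  finally have sum_w: "(\<Sum>v\<in>V. w v) = mst_weight V d" .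
  have "(\<Sum>v\<in>V'. w v) \<le> steiner_weight V d V'" if V': "V' \<subseteq> V" "v0 \<in> V'" for V'
  proof -
    obtain U E where st: "steiner_tree V V' U E"
      and weight: "total_weight d E = steiner_weight V d V'"
      using steiner_weight_attained[OF assms(1) V'(1)] V'(2) by blast
    then have U: "V' \<subseteq> U" "U \<subseteq> V" and E: "simple_graph U E" "graph_connected U E"
      by (auto simp: steiner_tree_def graph_tree_def)
    have "v0 \<in> U" using U V' by auto
    with p have pU: "parent_function V U p h" by (auto intro: parent_function_mono)
    let ?F = "parent_edges p (V - U)"
    have sE: "simple_graph V E" using E(1) U(2) assms(1) unfolding simple_graph_def by blast
    have sF: "simple_graph V ?F" using assms(1) pU by (rule simple_graph_parent_edges)
    have "mst_weight V d \<le> total_weight d (E \<union> ?F)"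
    proof (rule mst_weight_le_connected)
      show "simple_graph V (E \<union> ?F)" using sE sF by (simp add: simple_graph_def)
      show "graph_connected V (E \<union> ?F)" using E(2) U(2) pU by (rule graph_connected_parent_edges)
    qed (fact sym nonneg)+
    also have "\<dots> \<le> total_weight d E + total_weight d ?F"
      using sE sF sym nonneg by (rule total_weight_Un_le)
    also have "total_weight d ?F = (\<Sum>v\<in>V - U. d v (p v))"
      using pU sym by (rule total_weight_parent_edges)
    \<comment> \<open>The root \<open>v0\<close>, the only node where \<open>w\<close> is not
      defined by a parent edge, lies in \<open>U\<close>.\<close>
    also have "\<dots> = (\<Sum>v\<in>V - U. w v)"
      using \<open>v0 \<in> U\<close> by (intro sum.cong) (auto simp: w_def)
    finally have "(\<Sum>v\<in>U. w v) \<le> total_weight d E"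
      using sum_w sum.subset_diff[OF U(2) assms(1), of w] by simp
    \<comment> \<open>Passing from \<open>U\<close> to the terminals drops only the nonnegative
      weights of Steiner nodes.\<close>
    moreover have "(\<Sum>v\<in>V'. w v) \<le> (\<Sum>v\<in>U. w v)"
      using U assms(1) w_nonneg by (intro sum_mono2) (auto intro: finite_subset)
    ultimately show ?thesis using weight by simp
  qed
  then show ?thesis using star sum_w steiner_weight_eq_mst_weight[of V d] by auto
qed

end
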